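(* Let $n$ and $k$ be positive integers and let $G$ be a graph of order $n$ with minimum degree $\delta(G)\ge k$. Then $$ R'(G)\ \ge\ \begin{cases} \dfrac n2-\dfrac12\left(\dfrac1k-\dfrac1{n-1}\right)k(n-k) & \text{if } k\le \dfrac n2,\\[2ex] \dfrac n2-\dfrac12\left(\dfrac1k-\dfrac1{n-1}\right)\dfrac{n^2}{4} & \text{if } \dfrac n2\le k\le n-2. \end{cases} $$ Moreover, for $k\le \frac n2$, equality holds if and only if $G=K^*_{k,n-k}$ (up to isomorphism). For $\frac n2\le k\le n-2$, equality holds if ($n\equiv 0 \pmod 4$, or $n\equiv 2\pmod 4$ and $k$ is odd) and $G\in\mathcal G_{n,n/2,k}$.
   Context: Graphs are finite and simple. For a graph $G$, $d(u)$ denotes the degree of the vertex $u$, $E(G)$ the edge set, and $\delta(G)$ the minimum degree. The variation of the Randić index is $$R'(G)=\sum_{uv\in E(G)}\frac{1}{\max\{d(u),d(v)\}}.$$ The complete split graph $K^*_{k,n-k}$ is the graph on $n$ vertices obtained from the complete bipartite graph $K_{k,n-k}$ by adding all edges between pairs of vertices in the partite set of size $k$ (making these $k$ vertices pairwise adjacent). $\mathcal G_{n,p,k}$ denotes the family of $n$-vertex graphs obtained from the complete graph $K_n$ by deleting the edges of an $(n-k-1)$-regular graph on $p$ of the vertices; equivalently, the complements of graphs consisting of an $(n-k-1)$-regular graph on $p$ vertices together with $n-p$ isolated vertices. *)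

theory Defs
  imports Complex_Main
begin

record 'a ugraph =
  verts :: "'a set"
  edges :: "'a set set"

definition complete_edges :: "'a set \<Rightarrow> 'a set set" where
  "complete_edges V = {e. e \<subseteq> V \<and> card e = 2}"

definition simple_graph :: "'a ugraph \<Rightarrow> bool" where
  "simple_graph G \<longleftrightarrow> finite (verts G) \<and> edges G \<subseteq> complete_edges (verts G)"

definition graph_order :: "'a ugraph \<Rightarrow> nat" where
  "graph_order G = card (verts G)"

definition deg :: "'a ugraph \<Rightarrow> 'a \<Rightarrow> nat" where
  "deg G u = card {e \<in> edges G. u \<in> e}"

definition min_degree :: "'a ugraph \<Rightarrow> nat" where
  "min_degree G = Min (deg G ` verts G)"

definition regular :: "nat \<Rightarrow> 'a ugraph \<Rightarrow> bool" where
  "regular r G \<longleftrightarrow> (\<forall>u \<in> verts G. deg G u = r)"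

text \<open>An edge is a two-element set \<open>e = {u, v}\<close>, so \<open>Max (deg G ` e)\<close> is
  \<open>max (deg G u) (deg G v)\<close>, and every edge contributes exactly once.\<close>

definition randic_var :: "'a ugraph \<Rightarrow> real" where
  "randic_var G = (\<Sum>e\<in>edges G. 1 / real (Max (deg G ` e)))"

definition graph_iso :: "'a ugraph \<Rightarrow> 'b ugraph \<Rightarrow> bool" where
  "graph_iso G H \<longleftrightarrow> (\<exists>f. bij_betw f (verts G) (verts H) \<and>
     (\<forall>u \<in> verts G. \<forall>v \<in> verts G. {u, v} \<in> edges G \<longleftrightarrow> {f u, f v} \<in> edges H))"

definition complete_bipartite :: "nat \<Rightarrow> nat \<Rightarrow> nat ugraph" where
  "complete_bipartite k m =
     \<lparr>verts = {..<k + m}, edges = {{i, j} | i j. i \<in> {..<k} \<and> j \<in> {k..<k + m}}\<rparr>"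

definition complete_split :: "nat \<Rightarrow> nat \<Rightarrow> nat ugraph" where
  "complete_split k m =
     \<lparr>verts = verts (complete_bipartite k m),
      edges = edges (complete_bipartite k m) \<union> complete_edges {..<k}\<rparr>"

text \<open>The family \<open>\<G>\<^bsub>n,p,k\<^esub>\<close>: the complete graph on \<open>n\<close> vertices minus the edges of an
  \<open>(n - k - 1)\<close>-regular graph \<open>H\<close> on \<open>p\<close> of the vertices. The subtraction is on natural
  numbers, so the definition is meant for \<open>k < n\<close>. The vertex set is arbitrary, so the
  family is closed under isomorphism.\<close>

definition G_family :: "nat \<Rightarrow> nat \<Rightarrow> nat \<Rightarrow> 'a ugraph set" where
  "G_family n p k = {G. simple_graph G \<and> graph_order G = n \<and>
     (\<exists>H. simple_graph H \<and> verts H \<subseteq> verts G \<and> graph_order H = p \<and>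
          regular (n - k - 1) H \<and>
          edges G = complete_edges (verts G) - edges H)}"

end

theory Submission
  imports Defs
begin

text \<open>Since \<open>1 / max a b = 1 / a - max 0 (1 / a - 1 / b)\<close>, summing over ordered adjacent pairs
  \<open>(u, v)\<close> turns \<open>2 * R'(G)\<close> into \<open>n\<close> (every vertex contributes \<open>deg u * (1 / deg u)\<close>) minus the
  degree gap \<open>D\<close>, the sum of the positive parts of \<open>1 / deg u - 1 / deg v\<close>. So the lower bounds
  on \<open>R'\<close> are upper bounds on \<open>D\<close>.

  Let \<open>w i = 1 / i - 1 / (i + 1)\<close>. Telescoping \<open>1 / deg u - 1 / deg v\<close> gives
  \<open>D = (\<Sum>i = k..n - 2. w i * c i)\<close>, where \<open>c i\<close> is the number of edges joining a vertex of degree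
  at most \<open>i\<close> to a vertex of degree above \<open>i\<close> (\<open>degree_gap_layers\<close>). With \<open>b i\<close> vertices of
  degree above \<open>i\<close> there are two ways to bound a layer: \<open>c i \<le> b i * (n - b i)\<close>, and \<open>c i\<close> is at
  most the sum of the degrees that are at most \<open>i\<close>.

  The first bound gives \<open>c i \<le> n\<^sup>2 / 4\<close>, hence the estimate for \<open>n / 2 \<le> k\<close>.

  For \<open>k \<le> n / 2\<close> a single layer may well exceed \<open>k * (n - k)\<close>, so the two bounds have to be
  combined. Let \<open>s\<close> be the least \<open>i\<close> with \<open>b i \<le> k\<close>. The layers \<open>i \<ge> s\<close> satisfy
  \<open>c i \<le> k * (n - k)\<close>, because \<open>x * (n - x)\<close> increases up to \<open>n / 2\<close>. In the layers \<open>i < s\<close>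
  a vertex of degree \<open>d < s\<close> is charged at most \<open>d * (1 / d - 1 / s) \<le> 1 - k / s\<close> in total,
  and fewer than \<open>n - k\<close> vertices have such a degree, so these layers together weigh less than
  \<open>(n - k) * (1 - k / s) = k * (n - k) * (1 / k - 1 / s)\<close>, which is exactly what \<open>k * (n - k)\<close>
  per layer would give (if \<open>s = k\<close> there are no such layers). Equality therefore
  forces \<open>s = k\<close> and all layers tight. For \<open>k < n - 1\<close> this leaves \<open>k\<close> vertices of degree
  \<open>n - 1\<close> and \<open>n - k\<close> vertices of degree \<open>k\<close>, the complete split graph; otherwise \<open>G\<close> is a
  single edge.

  Conversely, a graph whose only degrees are \<open>k\<close> and \<open>n - 1\<close> has all its layers equal
  (\<open>randic_var_two_degrees\<close>); this evaluates the index of the complete split graphs and of the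
  complements of regular graphs alike.\<close>

section \<open>Neighbourhoods and double counting\<close>

definition nbrs :: "'a ugraph \<Rightarrow> 'a \<Rightarrow> 'a set" where
  "nbrs G u = {v. {u, v} \<in> edges G}"

lemma nbrs_sym: "v \<in> nbrs G u \<longleftrightarrow> u \<in> nbrs G v"
  by (simp add: nbrs_def insert_commute)

lemma nbrs_subset:
  assumes "simple_graph G"
  shows "nbrs G u \<subseteq> verts G - {u}"
proof
  fix v assume "v \<in> nbrs G u"
  then have "{u, v} \<subseteq> verts G" "card {u, v} = 2"
    using assms by (auto simp: nbrs_def simple_graph_def complete_edges_def)
  then show "v \<in> verts G - {u}" by (cases "u = v") auto
qed

lemma finite_nbrs: "simple_graph G \<Longrightarrow> finite (nbrs G u)"
  by (meson finite_Diff finite_subset nbrs_subset simple_graph_def)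

lemma finite_edges: "simple_graph G \<Longrightarrow> finite (edges G)"
  by (rule finite_subset[of _ "Pow (verts G)"]) (auto simp: simple_graph_def complete_edges_def)

lemma bij_betw_nbrs_incident:
  assumes "simple_graph G"
  shows "bij_betw (\<lambda>v. {u, v}) (nbrs G u) {e \<in> edges G. u \<in> e}"
  unfolding bij_betw_def
proof
  show "inj_on (\<lambda>v. {u, v}) (nbrs G u)"
    by (auto simp: inj_on_def doubleton_eq_iff)
  show "(\<lambda>v. {u, v}) ` nbrs G u = {e \<in> edges G. u \<in> e}"
  proof
    show "{e \<in> edges G. u \<in> e} \<subseteq> (\<lambda>v. {u, v}) ` nbrs G u"
    proof
      fix e assume e: "e \<in> {e \<in> edges G. u \<in> e}"
      then have "card e = 2" using assms by (auto simp: simple_graph_def complete_edges_def)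
      with e obtain v where "e = {u, v}" by (auto simp: card_2_iff)
      with e show "e \<in> (\<lambda>v. {u, v}) ` nbrs G u" by (auto simp: nbrs_def)
    qed
  qed (auto simp: nbrs_def)
qed

lemma card_nbrs: "simple_graph G \<Longrightarrow> card (nbrs G u) = deg G u"
  unfolding deg_def by (rule bij_betw_same_card[OF bij_betw_nbrs_incident])

lemma deg_le_order:
  assumes "simple_graph G" "u \<in> verts G"
  shows "deg G u \<le> graph_order G - 1"
  using card_mono[OF _ nbrs_subset[OF assms(1), of u]] assms
  by (simp add: card_nbrs graph_order_def simple_graph_def)

lemma nbrs_full_degree:
  assumes "simple_graph G" "u \<in> verts G" "deg G u = graph_order G - 1"
  shows "nbrs G u = verts G - {u}"
  using assms nbrs_subset[OF assms(1), of u]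
  by (intro card_subset_eq) (auto simp: simple_graph_def card_nbrs graph_order_def)

text \<open>Ordered pairs are easier to split by the degrees of their two ends than two-element sets; this
  is the passage between the two, a weighted handshake.\<close>

lemma sum_over_edges_twice:
  fixes g :: "'a set \<Rightarrow> real"
  assumes "simple_graph G"
  shows "(\<Sum>u\<in>verts G. \<Sum>v\<in>nbrs G u. g {u, v}) = 2 * (\<Sum>e\<in>edges G. g e)"
proof -
  have fin: "finite (verts G)" "finite (edges G)"
    using assms finite_edges by (auto simp: simple_graph_def)
  have "(\<Sum>v\<in>nbrs G u. g {u, v}) = (\<Sum>e\<in>edges G. if u \<in> e then g e else 0)" for u
    using sum.reindex_bij_betw[OF bij_betw_nbrs_incident[OF assms, of u], of g] fin
    by (simp add: sum.inter_filter)
  then have "(\<Sum>u\<in>verts G. \<Sum>v\<in>nbrs G u. g {u, v})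
      = (\<Sum>u\<in>verts G. \<Sum>e\<in>edges G. if u \<in> e then g e else 0)" by simp
  also have "\<dots> = (\<Sum>e\<in>edges G. \<Sum>u\<in>verts G. if u \<in> e then g e else 0)"
    by (rule sum.swap)
  also have "\<dots> = (\<Sum>e\<in>edges G. 2 * g e)"
  proof (rule sum.cong)
    fix e assume "e \<in> edges G"
    then have e: "e \<subseteq> verts G" "card e = 2"
      using assms by (auto simp: simple_graph_def complete_edges_def)
    have "(\<Sum>u\<in>verts G. if u \<in> e then g e else 0) = (\<Sum>u\<in>{u \<in> verts G. u \<in> e}. g e)"
      by (rule sum.inter_filter[OF fin(1), symmetric])
    also have "{u \<in> verts G. u \<in> e} = e" using e by auto
    finally show "(\<Sum>u\<in>verts G. if u \<in> e then g e else 0) = 2 * g e" using e by simp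
  qed simp
  finally show ?thesis by (simp add: sum_distrib_left)
qed

section \<open>The deficit of the index and its decomposition into cuts\<close>

definition degree_gap :: "'a ugraph \<Rightarrow> real" where
  "degree_gap G = (\<Sum>u\<in>verts G. \<Sum>v\<in>nbrs G u. max 0 (1 / real (deg G u) - 1 / real (deg G v)))"

text \<open>Each vertex \<open>u\<close> would contribute \<open>deg u * (1 / deg u) = 1\<close> if it had the larger degree on all
  its edges; the degree gap is what is lost on edges to vertices of larger degree.\<close>

lemma randic_var_eq_degree_gap:
  assumes G: "simple_graph G" and pos: "\<And>u. u \<in> verts G \<Longrightarrow> deg G u > 0"
  shows "randic_var G = real (graph_order G) / 2 - degree_gap G / 2"
proof -
  have "2 * randic_var G = (\<Sum>u\<in>verts G. \<Sum>v\<in>nbrs G u. 1 / real (Max (deg G ` {u, v})))"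
    unfolding randic_var_def
    by (rule sum_over_edges_twice[OF G, of "\<lambda>e. 1 / real (Max (deg G ` e))", symmetric])
  also have "\<dots> = (\<Sum>u\<in>verts G. \<Sum>v\<in>nbrs G u. 1 / real (deg G u)
        - max 0 (1 / real (deg G u) - 1 / real (deg G v)))"
  proof (intro sum.cong refl)
    fix u v assume "u \<in> verts G" "v \<in> nbrs G u"
    then have "deg G u > 0" "deg G v > 0" using nbrs_subset[OF G, of u] pos by auto
    then show "1 / real (Max (deg G ` {u, v})) = 1 / real (deg G u)
        - max 0 (1 / real (deg G u) - 1 / real (deg G v))"
      by (cases "deg G u \<le> deg G v") (auto simp: max_def field_simps)
  qed
  also have "\<dots> = (\<Sum>u\<in>verts G. \<Sum>v\<in>nbrs G u. 1 / real (deg G u)) - degree_gap G"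
    by (simp add: sum_subtractf degree_gap_def)
  also have "(\<Sum>u\<in>verts G. \<Sum>v\<in>nbrs G u. 1 / real (deg G u)) = (\<Sum>u\<in>verts G. 1)"
    using pos by (intro sum.cong refl) (force simp: card_nbrs[OF G])
  finally show ?thesis by (simp add: graph_order_def)
qed

definition cut :: "'a ugraph \<Rightarrow> nat \<Rightarrow> ('a \<times> 'a) set" where
  "cut G i = {(u, v). u \<in> verts G \<and> v \<in> nbrs G u \<and> deg G u \<le> i \<and> i < deg G v}"

definition above :: "'a ugraph \<Rightarrow> nat \<Rightarrow> 'a set" where
  "above G i = {v \<in> verts G. i < deg G v}"

lemma finite_above: "simple_graph G \<Longrightarrow> finite (above G i)"
  by (simp add: above_def simple_graph_def)

lemma card_above_le: "simple_graph G \<Longrightarrow> card (above G i) \<le> graph_order G"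
  unfolding graph_order_def by (rule card_mono) (auto simp: above_def simple_graph_def)

lemma card_not_above:
  assumes "simple_graph G"
  shows "card {u \<in> verts G. deg G u \<le> i} = graph_order G - card (above G i)"
proof -
  have "{u \<in> verts G. deg G u \<le> i} = verts G - above G i" by (auto simp: above_def)
  then show ?thesis
    using card_Diff_subset[OF finite_above[OF assms], of i "verts G"]
    by (simp add: graph_order_def above_def)
qed

lemma telescope_reciprocals:
  "a \<le> b \<Longrightarrow> (\<Sum>i\<in>{a..<b}. 1 / real i - 1 / real (Suc i)) = 1 / real a - 1 / real b"
  using sum_Suc_diff'[of a b "\<lambda>i. - (1 / real i)"] by simp

lemma positive_part_as_layers:
  fixes a b l m :: nat
  assumes "1 \<le> l" "l \<le> a" "1 \<le> b" "b \<le> m"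
  shows "max 0 (1 / real a - 1 / real b)
    = (\<Sum>i\<in>{l..<m}. if a \<le> i \<and> i < b then 1 / real i - 1 / real (Suc i) else 0)"
proof -
  have "(\<Sum>i\<in>{l..<m}. if a \<le> i \<and> i < b then 1 / real i - 1 / real (Suc i) else 0)
      = (\<Sum>i\<in>{i \<in> {l..<m}. a \<le> i \<and> i < b}. 1 / real i - 1 / real (Suc i))"
    by (rule sum.inter_filter[symmetric]) simp
  also have "{i \<in> {l..<m}. a \<le> i \<and> i < b} = {a..<b}" using assms by auto
  finally have *: "(\<Sum>i\<in>{l..<m}. if a \<le> i \<and> i < b then 1 / real i - 1 / real (Suc i) else 0)
      = (\<Sum>i\<in>{a..<b}. 1 / real i - 1 / real (Suc i))" .
  show ?thesis
  proof (cases "a \<le> b")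
    case True
    then have "1 / real b \<le> 1 / real a" using assms by (intro divide_left_mono) auto
    then show ?thesis unfolding * telescope_reciprocals[OF True] by simp
  next
    case False
    then have "1 / real a \<le> 1 / real b" using assms by (intro divide_left_mono) auto
    then show ?thesis unfolding * using False by simp
  qed
qed

text \<open>The reciprocals telescope along \<open>deg u \<le> i < deg v\<close>, and exchanging the two sums counts, for
  each \<open>i\<close>, the edges crossing from degree at most \<open>i\<close> to degree above \<open>i\<close>.\<close>

lemma degree_gap_layers:
  assumes G: "simple_graph G" and l: "1 \<le> l" "\<And>u. u \<in> verts G \<Longrightarrow> l \<le> deg G u"
  shows "degree_gap G = (\<Sum>i\<in>{l..<graph_order G - 1}.
            (1 / real i - 1 / real (Suc i)) * real (card (cut G i)))"
proof -
  let ?w = "\<lambda>i. 1 / real i - 1 / real (Suc i)" and ?I = "{l..<graph_order G - 1}"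
  let ?P = "Sigma (verts G) (nbrs G)"
  have fin: "finite (verts G)" "\<forall>u\<in>verts G. finite (nbrs G u)"
    using G finite_nbrs[OF G] by (auto simp: simple_graph_def)
  have finP: "finite ?P" using fin by (intro finite_SigmaI) auto
  have "degree_gap G = (\<Sum>(u, v)\<in>?P. max 0 (1 / real (deg G u) - 1 / real (deg G v)))"
    unfolding degree_gap_def by (rule sum.Sigma[OF fin])
  also have "\<dots> = (\<Sum>(u, v)\<in>?P. \<Sum>i\<in>?I. if deg G u \<le> i \<and> i < deg G v then ?w i else 0)"
  proof (rule sum.cong[OF refl], clarify)
    fix u v assume uv: "u \<in> verts G" "v \<in> nbrs G u"
    then have v: "v \<in> verts G" using nbrs_subset[OF G] by blast
    show "max 0 (1 / real (deg G u) - 1 / real (deg G v))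
      = (\<Sum>i\<in>?I. if deg G u \<le> i \<and> i < deg G v then ?w i else 0)"
      using l(1) l(2)[OF uv(1)] l(2)[OF v] deg_le_order[OF G v]
      by (intro positive_part_as_layers) auto
  qed
  also have "\<dots> = (\<Sum>p\<in>?P. \<Sum>i\<in>?I. if p \<in> cut G i then ?w i else 0)"
    by (intro sum.cong refl) (auto simp: cut_def)
  also have "\<dots> = (\<Sum>i\<in>?I. \<Sum>p\<in>?P. if p \<in> cut G i then ?w i else 0)"
    by (rule sum.swap)
  also have "\<dots> = (\<Sum>i\<in>?I. ?w i * real (card (cut G i)))"
  proof (rule sum.cong[OF refl])
    fix i
    have "{p \<in> ?P. p \<in> cut G i} = cut G i" by (auto simp: cut_def)
    then show "(\<Sum>p\<in>?P. if p \<in> cut G i then ?w i else 0) = ?w i * real (card (cut G i))"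
      using sum.inter_filter[OF finP, of "\<lambda>_. ?w i" "\<lambda>p. p \<in> cut G i"]
      by (simp add: mult.commute del: of_nat_Suc)
  qed
  finally show ?thesis .
qed

lemma cut_le_product:
  assumes G: "simple_graph G"
  shows "card (cut G i) \<le> (graph_order G - card (above G i)) * card (above G i)"
proof -
  have "cut G i \<subseteq> {u \<in> verts G. deg G u \<le> i} \<times> above G i"
    using nbrs_subset[OF G] by (fastforce simp: cut_def above_def)
  then have "card (cut G i) \<le> card ({u \<in> verts G. deg G u \<le> i} \<times> above G i)"
    using G finite_above[OF G] by (intro card_mono finite_cartesian_product)
      (auto simp: simple_graph_def)
  then show ?thesis by (simp add: card_cartesian_product card_not_above[OF G])
qed

text \<open>Each edge of the cut is seen from its end of small degree. It improves on
  the product of the sides when these degrees are smaller than the number of vertices above \<open>i\<close>.\<close>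

lemma cut_le_degree_sum:
  assumes G: "simple_graph G"
  shows "card (cut G i) \<le> (\<Sum>u\<in>{u \<in> verts G. deg G u \<le> i}. deg G u)"
proof -
  let ?L = "{u \<in> verts G. deg G u \<le> i}"
  have fin: "finite ?L" "\<forall>u\<in>?L. finite (nbrs G u)"
    using G finite_nbrs[OF G] by (auto simp: simple_graph_def)
  have "card (cut G i) \<le> card (Sigma ?L (nbrs G))"
    using fin by (intro card_mono finite_SigmaI) (auto simp: cut_def)
  then show ?thesis using fin by (simp add: card_nbrs[OF G])
qed

section \<open>Graphs whose degrees are only k and n - 1\<close>

text \<open>A vertex of degree \<open>n - 1\<close> is adjacent to everything, so every layer of the degree gap is the
  full product \<open>(verts G - B) \<times> B\<close> and the sum telescopes.\<close>

lemma randic_var_two_degrees: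
  assumes G: "simple_graph G" and n: "graph_order G = n" and k: "1 \<le> k" "k \<le> n - 1"
    and B: "B \<subseteq> verts G" "\<And>u. u \<in> B \<Longrightarrow> deg G u = n - 1"
      "\<And>u. u \<in> verts G - B \<Longrightarrow> deg G u = k"
  shows "randic_var G = real n / 2
    - 1 / 2 * (1 / real k - 1 / (real n - 1)) * (real (card B) * (real n - real (card B)))"
proof -
  have finV: "finite (verts G)" using G by (simp add: simple_graph_def)
  then have finB: "finite B" using B(1) finite_subset by blast
  have deg: "k \<le> deg G u" if "u \<in> verts G" for u
    using that B(2,3) k by (cases "u \<in> B") auto
  have "cut G i = (verts G - B) \<times> B" if i: "i \<in> {k..<n - 1}" for i
  proof -
    have full: "nbrs G v = verts G - {v}" if "v \<in> B" for v
      using nbrs_full_degree[OF G] B that n by blast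
    have lo: "u \<in> verts G - B" if "u \<in> verts G" "deg G u \<le> i" for u
      using that B(2)[of u] i by auto
    have hi: "v \<in> B" if "v \<in> verts G" "i < deg G v" for v
      using that B(3)[of v] i by auto
    show ?thesis
    proof (intro set_eqI iffI; clarify)
      fix u v assume "(u, v) \<in> cut G i"
      then have uv: "u \<in> verts G" "v \<in> nbrs G u" "deg G u \<le> i" "i < deg G v"
        by (auto simp: cut_def)
      then have "v \<in> verts G" using nbrs_subset[OF G] by blast
      then show "u \<in> verts G - B \<and> v \<in> B" using uv lo hi by blast
    next
      fix u v assume uv: "u \<in> verts G" "u \<notin> B" "v \<in> B"
      then have "u \<in> nbrs G v" using full by blast
      then have "v \<in> nbrs G u" using nbrs_sym by metis
      then show "(u, v) \<in> cut G i"
        using uv B(2)[of v] B(3)[of u] i by (simp add: cut_def)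
    qed
  qed
  then have "degree_gap G = (\<Sum>i\<in>{k..<n - 1}.
        (1 / real i - 1 / real (Suc i)) * real (card ((verts G - B) \<times> B)))"
    using degree_gap_layers[OF G k(1)] deg n by (simp del: of_nat_Suc)
  also have "\<dots> = (1 / real k - 1 / real (n - 1)) * real (card ((verts G - B) \<times> B))"
    using telescope_reciprocals[OF k(2)] by (simp only: sum_distrib_right[symmetric])
  also have "card ((verts G - B) \<times> B) = (n - card B) * card B"
    using finB B(1) n by (simp add: card_cartesian_product card_Diff_subset graph_order_def)
  finally have "degree_gap G = (1 / real k - 1 / real (n - 1)) * real ((n - card B) * card B)" .
  moreover have "card B \<le> n" using B(1) finV n card_mono graph_order_def by metis
  moreover have "real (n - 1) = real n - 1" using k by simp
  moreover have "deg G u > 0" if "u \<in> verts G" for u using deg[OF that] k by simp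
  ultimately show ?thesis
    using randic_var_eq_degree_gap[OF G] n by (simp add: of_nat_diff mult_ac)
qed

section \<open>Complete split graphs\<close>

lemma complete_split_edge_iff:
  assumes "i < k + m" "j < k + m"
  shows "{i, j} \<in> edges (complete_split k m) \<longleftrightarrow> i \<noteq> j \<and> (i < k \<or> j < k)"
proof
  assume "{i, j} \<in> edges (complete_split k m)"
  then show "i \<noteq> j \<and> (i < k \<or> j < k)"
    by (auto simp: complete_split_def complete_bipartite_def complete_edges_def doubleton_eq_iff
        card_2_iff)
next
  assume ij: "i \<noteq> j \<and> (i < k \<or> j < k)"
  show "{i, j} \<in> edges (complete_split k m)"
  proof (cases "i < k \<and> j < k")
    case True
    then show ?thesis using ij by (auto simp: complete_split_def complete_edges_def)
  next
    case False
    have "{i, j} \<in> edges (complete_bipartite k m)"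
    proof (cases "i < k")
      case True
      then have "i \<in> {..<k} \<and> j \<in> {k..<k + m}" using False assms by auto
      then show ?thesis by (auto simp only: complete_bipartite_def ugraph.simps)
    next
      case i: False
      then have "j \<in> {..<k} \<and> i \<in> {k..<k + m}" using ij assms by auto
      then have "{j, i} \<in> edges (complete_bipartite k m)"
        by (auto simp only: complete_bipartite_def ugraph.simps)
      then show ?thesis by (simp add: insert_commute)
    qed
    then show ?thesis by (simp add: complete_split_def)
  qed
qed

lemma verts_complete_split: "verts (complete_split k m) = {..<k + m}"
  by (simp add: complete_split_def complete_bipartite_def)

text \<open>Up to isomorphism only the part \<open>B\<close> of size \<open>k\<close> matters: a bijection onto \<open>{..<n}\<close> can be glued
  from any bijections \<open>B \<rightarrow> {..<k}\<close> and \<open>verts G - B \<rightarrow> {k..<n}\<close>.\<close>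

lemma graph_iso_complete_split_iff:
  assumes G: "simple_graph G" and n: "graph_order G = n" and k: "k \<le> n"
  shows "graph_iso G (complete_split k (n - k)) \<longleftrightarrow>
    (\<exists>B \<subseteq> verts G. card B = k \<and>
      (\<forall>u\<in>verts G. \<forall>v\<in>verts G. v \<in> nbrs G u \<longleftrightarrow> u \<noteq> v \<and> (u \<in> B \<or> v \<in> B)))"
    (is "_ \<longleftrightarrow> (\<exists>B \<subseteq> verts G. ?split B)")
proof
  assume "graph_iso G (complete_split k (n - k))"
  then obtain f where f: "bij_betw f (verts G) {..<n}"
    and e: "\<And>u v. u \<in> verts G \<Longrightarrow> v \<in> verts G \<Longrightarrow>
       {u, v} \<in> edges G \<longleftrightarrow> {f u, f v} \<in> edges (complete_split k (n - k))"
    using k by (auto simp: graph_iso_def verts_complete_split)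
  let ?B = "{u \<in> verts G. f u < k}"
  have lt: "f u < k + (n - k)" if "u \<in> verts G" for u
    using f that k by (auto simp: bij_betw_def)
  have "f ` ?B = {..<k}"
  proof
    show "{..<k} \<subseteq> f ` ?B"
    proof
      fix i assume "i \<in> {..<k}"
      then have "i < k" "i \<in> f ` verts G" using f k by (auto simp: bij_betw_def)
      then show "i \<in> f ` ?B" by auto
    qed
  qed auto
  moreover have inj: "inj_on f (verts G)" using f by (simp add: bij_betw_def)
  then have "inj_on f ?B" by (rule inj_on_subset) auto
  then have "card (f ` ?B) = card ?B" by (rule card_image)
  ultimately have "card ?B = k" by simp
  moreover have "v \<in> nbrs G u \<longleftrightarrow> u \<noteq> v \<and> (u \<in> ?B \<or> v \<in> ?B)"
    if "u \<in> verts G" "v \<in> verts G" for u v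
    using that e[OF that] complete_split_edge_iff[OF lt lt, OF that] inj_on_eq_iff[OF inj that]
    by (simp add: nbrs_def)
  ultimately show "\<exists>B \<subseteq> verts G. ?split B" by (intro exI[of _ ?B]) simp
next
  assume "\<exists>B \<subseteq> verts G. ?split B"
  then obtain B where B: "B \<subseteq> verts G" "card B = k"
    and nb: "\<And>u v. u \<in> verts G \<Longrightarrow> v \<in> verts G \<Longrightarrow>
      v \<in> nbrs G u \<longleftrightarrow> u \<noteq> v \<and> (u \<in> B \<or> v \<in> B)" by auto
  have finV: "finite (verts G)" using G by (simp add: simple_graph_def)
  then have finB: "finite B" using B(1) finite_subset by blast
  obtain g where g: "bij_betw g B {..<k}"
    using finite_same_card_bij[OF finB, of "{..<k}"] B(2) by auto
  obtain h where h: "bij_betw h (verts G - B) {k..<n}"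
    using finite_same_card_bij[of "verts G - B" "{k..<n}"] finV finB B n
    by (auto simp: card_Diff_subset graph_order_def)
  define f where "f u = (if u \<in> B then g u else h u)" for u
  have "bij_betw f (B \<union> (verts G - B)) ({..<k} \<union> {k..<n})"
    using g h unfolding f_def by (intro bij_betw_disjoint_Un) auto
  moreover have "B \<union> (verts G - B) = verts G" using B(1) by auto
  moreover have "{..<k} \<union> {k..<n} = {..<n}" using k by auto
  ultimately have f: "bij_betw f (verts G) {..<n}" by simp
  have lt: "f u < k + (n - k)" if "u \<in> verts G" for u
    using f that k by (auto simp: bij_betw_def)
  have low: "f u < k \<longleftrightarrow> u \<in> B" if "u \<in> verts G" for u
    using bij_betwE[OF g] bij_betwE[OF h] that by (force simp: f_def)
  have "{u, v} \<in> edges G \<longleftrightarrow> {f u, f v} \<in> edges (complete_split k (n - k))"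
    if "u \<in> verts G" "v \<in> verts G" for u v
    using nb[OF that] complete_split_edge_iff[OF lt lt, OF that] low that
      inj_on_eq_iff[OF bij_betw_imp_inj_on[OF f] that]
    by (simp add: nbrs_def)
  then show "graph_iso G (complete_split k (n - k))"
    using f k by (auto simp: graph_iso_def verts_complete_split intro!: exI[of _ f])
qed

lemma complete_split_degrees:
  assumes G: "simple_graph G" and n: "graph_order G = n"
    and B: "B \<subseteq> verts G" "card B = k"
    and nb: "\<And>u v. u \<in> verts G \<Longrightarrow> v \<in> verts G \<Longrightarrow>
      v \<in> nbrs G u \<longleftrightarrow> u \<noteq> v \<and> (u \<in> B \<or> v \<in> B)"
    and u: "u \<in> verts G"
  shows "deg G u = (if u \<in> B then n - 1 else k)"
proof -
  have "nbrs G u = (if u \<in> B then verts G - {u} else B)"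
    using nb[OF u] nbrs_subset[OF G, of u] B(1) u by auto
  then show ?thesis using u n B(2) G
    by (auto simp: card_nbrs[OF G, symmetric] graph_order_def simple_graph_def)
qed


text \<open>The vertices of \<open>B\<close> are adjacent to everything; a vertex outside \<open>B\<close> thus has all of \<open>B\<close> as
  neighbours, and its degree leaves room for no others.\<close>

lemma complete_split_structure_of_degrees:
  assumes G: "simple_graph G" and n: "graph_order G = n"
    and B: "B \<subseteq> verts G" "\<And>u. u \<in> B \<Longrightarrow> deg G u = n - 1"
      "\<And>u. u \<in> verts G - B \<Longrightarrow> deg G u = card B"
    and uv: "u \<in> verts G" "v \<in> verts G"
  shows "v \<in> nbrs G u \<longleftrightarrow> u \<noteq> v \<and> (u \<in> B \<or> v \<in> B)"
proof -
  have full: "nbrs G w = verts G - {w}" if "w \<in> B" for w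
    using nbrs_full_degree[OF G] B(1,2) that n by blast
  show ?thesis
  proof (cases "u \<in> B")
    case True
    then show ?thesis using full uv by auto
  next
    case False
    have "B \<subseteq> nbrs G u"
    proof
      fix w assume "w \<in> B"
      then have "u \<in> nbrs G w" using full False uv by auto
      then show "w \<in> nbrs G u" using nbrs_sym by metis
    qed
    moreover have "card (nbrs G u) = card B"
      using B(3) False uv by (simp add: card_nbrs[OF G])
    ultimately have "B = nbrs G u" by (intro card_subset_eq finite_nbrs[OF G]) auto
    then show ?thesis using False by blast
  qed
qed

section \<open>The two upper bounds for the deficit\<close>

text \<open>A vertex of degree \<open>d < s\<close> lies in the layers \<open>d, \<dots>, s - 1\<close> with at most \<open>d\<close> edges in each, so
  its total charge is at most \<open>d * (1 / d - 1 / s) = 1 - d / s\<close>.\<close>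

lemma low_layers_le:
  assumes G: "simple_graph G" and k: "1 \<le> k" "k \<le> s"
    and deg: "\<And>u. u \<in> verts G \<Longrightarrow> k \<le> deg G u"
  shows "(\<Sum>i\<in>{k..<s}. (1 / real i - 1 / real (Suc i)) * real (card (cut G i)))
    \<le> real (card {u \<in> verts G. deg G u < s}) * (1 - real k / real s)"
proof -
  let ?w = "\<lambda>i. 1 / real i - 1 / real (Suc i)"
  have finV: "finite (verts G)" using G by (simp add: simple_graph_def)
  have "(\<Sum>i\<in>{k..<s}. ?w i * real (card (cut G i)))
      \<le> (\<Sum>i\<in>{k..<s}. ?w i * real (\<Sum>u\<in>{u \<in> verts G. deg G u \<le> i}. deg G u))"
  proof (intro sum_mono mult_left_mono)
    fix i assume "i \<in> {k..<s}"
    then show "0 \<le> ?w i" using k by (simp add: field_simps)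
    show "real (card (cut G i)) \<le> real (\<Sum>u\<in>{u \<in> verts G. deg G u \<le> i}. deg G u)"
      using cut_le_degree_sum[OF G] by (simp only: of_nat_le_iff)
  qed
  also have "\<dots> = (\<Sum>i\<in>{k..<s}. \<Sum>u\<in>verts G. if deg G u \<le> i then ?w i * real (deg G u) else 0)"
    using finV by (simp add: sum.inter_filter[symmetric] sum_distrib_left)
  also have "\<dots> = (\<Sum>u\<in>verts G. \<Sum>i\<in>{k..<s}. if deg G u \<le> i then ?w i * real (deg G u) else 0)"
    by (rule sum.swap)
  also have "\<dots> \<le> (\<Sum>u\<in>verts G. if deg G u < s then 1 - real k / real s else 0)"
  proof (rule sum_mono)
    fix u assume u: "u \<in> verts G"
    have "{i \<in> {k..<s}. deg G u \<le> i} = {deg G u..<s}" using deg[OF u] by auto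
    then have *: "(\<Sum>i\<in>{k..<s}. if deg G u \<le> i then ?w i * real (deg G u) else 0)
        = (\<Sum>i\<in>{deg G u..<s}. ?w i) * real (deg G u)"
      by (simp add: sum.inter_filter[symmetric] sum_distrib_right)
    show "(\<Sum>i\<in>{k..<s}. if deg G u \<le> i then ?w i * real (deg G u) else 0)
        \<le> (if deg G u < s then 1 - real k / real s else 0)"
    proof (cases "deg G u < s")
      case True
      then have "(\<Sum>i\<in>{deg G u..<s}. ?w i) * real (deg G u) = 1 - real (deg G u) / real s"
        using telescope_reciprocals[of "deg G u" s] deg[OF u] k by (simp add: field_simps)
      also have "\<dots> \<le> 1 - real k / real s" using deg[OF u] by (simp add: divide_right_mono)
      finally show ?thesis using True * by simp
    qed (use * in simp)
  qed
  also have "\<dots> = real (card {u \<in> verts G. deg G u < s}) * (1 - real k / real s)"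
    using finV by (simp add: sum.inter_filter[symmetric])
  finally show ?thesis .
qed

lemma product_gap:
  fixes n k b :: real
  shows "k * (n - k) - b * (n - b) = (k - b) * (n - k - b)"
  by (simp add: algebra_simps)

lemma degree_gap_le_quarter:
  assumes G: "simple_graph G" and n: "graph_order G = n" and k: "1 \<le> k" "k \<le> n - 1"
    and deg: "\<And>u. u \<in> verts G \<Longrightarrow> k \<le> deg G u"
  shows "degree_gap G \<le> (1 / real k - 1 / (real n - 1)) * ((real n)\<^sup>2 / 4)"
proof -
  have "degree_gap G = (\<Sum>i\<in>{k..<n - 1}. (1 / real i - 1 / real (Suc i)) * real (card (cut G i)))"
    using degree_gap_layers[OF G k(1) deg] n by simp
  also have "\<dots> \<le> (\<Sum>i\<in>{k..<n - 1}. (1 / real i - 1 / real (Suc i)) * ((real n)\<^sup>2 / 4))"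
  proof (intro sum_mono mult_left_mono)
    fix i assume "i \<in> {k..<n - 1}"
    then show "0 \<le> 1 / real i - 1 / real (Suc i)" using k by (simp add: field_simps)
    let ?b = "real (card (above G i))"
    have "real (card (cut G i)) \<le> real ((n - card (above G i)) * card (above G i))"
      using cut_le_product[OF G, of i] n by (simp only: of_nat_le_iff)
    also have "\<dots> = (real n - ?b) * ?b"
      using card_above_le[OF G, of i] n by (simp add: of_nat_diff)
    also have "\<dots> = (real n)\<^sup>2 / 4 - (real n / 2 - ?b)\<^sup>2"
      by (simp add: power2_eq_square field_simps)
    also have "\<dots> \<le> (real n)\<^sup>2 / 4" by simp
    finally show "real (card (cut G i)) \<le> (real n)\<^sup>2 / 4" .
  qed
  also have "\<dots> = (1 / real k - 1 / real (n - 1)) * ((real n)\<^sup>2 / 4)"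
    using telescope_reciprocals[OF k(2)] by (simp only: sum_distrib_right[symmetric])
  also have "real (n - 1) = real n - 1" using k by simp
  finally show ?thesis .
qed

text \<open>The layers are cut at the least \<open>s\<close> such that at most \<open>k\<close> vertices have degree above \<open>s\<close>: from
  \<open>s\<close> on each layer is bounded by the product of its sides, below \<open>s\<close> the layers are bounded
  jointly through the degrees. If \<open>k < s\<close> the joint bound is strict, so in the extremal case there is
  nothing below \<open>s\<close>, and the first and the last layer determine the degrees.\<close>

lemma degree_gap_le_split:
  assumes G: "simple_graph G" and n: "graph_order G = n" and k: "1 \<le> k" "2 * k \<le> n"
    and deg: "\<And>u. u \<in> verts G \<Longrightarrow> k \<le> deg G u"
  defines "M \<equiv> (1 / real k - 1 / (real n - 1)) * (real k * (real n - real k))"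
  shows "degree_gap G \<le> M"
    and "degree_gap G = M \<Longrightarrow> \<exists>B \<subseteq> verts G. card B = k \<and>
      (\<forall>u\<in>B. deg G u = n - 1) \<and> (\<forall>u\<in>verts G - B. deg G u = k)"
proof -
  let ?w = "\<lambda>i. 1 / real i - 1 / real (Suc i)"
  let ?c = "\<lambda>i. real (card (cut G i))"
  let ?p = "real k * (real n - real k)"
  have finV: "finite (verts G)" using G by (simp add: simple_graph_def)
  have kn: "k \<le> n - 1" using k by simp
  have w_pos: "?w i > 0" if "k \<le> i" for i
    using that k by (simp add: field_simps add_pos_nonneg)
  have gap: "degree_gap G = (\<Sum>i\<in>{k..<n - 1}. ?w i * ?c i)"
    using degree_gap_layers[OF G k(1) deg] n by simp
  have M_sum: "M = (\<Sum>i\<in>{k..<n - 1}. ?w i * ?p)"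
    using telescope_reciprocals[OF kn] k
    by (simp add: M_def sum_distrib_right[symmetric] of_nat_diff)
  have cut_le: "?c i \<le> ?p - (real k - real (card (above G i))) * (real n - real k - real (card (above G i)))"
    for i
  proof -
    let ?b = "card (above G i)"
    have "?c i \<le> real ((n - ?b) * ?b)"
      using cut_le_product[OF G, of i] n by (simp only: of_nat_le_iff)
    also have "\<dots> = real ?b * (real n - real ?b)"
      using card_above_le[OF G, of i] n by (simp add: of_nat_diff)
    finally show ?thesis using product_gap[of "real k" "real n" "real ?b"] by simp
  qed
  have cut_le_p: "?c i \<le> ?p" if "card (above G i) \<le> k" for i
  proof -
    have "0 \<le> (real k - real (card (above G i))) * (real n - real k - real (card (above G i)))"
      using that k by (intro mult_nonneg_nonneg) auto
    then show ?thesis using cut_le[of i] by simp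
  qed
  (* b * (n - b) is strictly below k * (n - k) for b < k, because then also b < n - k. *)
  have above_eq: "card (above G i) = k" if "card (above G i) \<le> k" "?c i = ?p" for i
  proof (rule ccontr)
    assume "card (above G i) \<noteq> k"
    then have "0 < (real k - real (card (above G i))) * (real n - real k - real (card (above G i)))"
      using that k by (intro mult_pos_pos) auto
    then show False using cut_le[of i] that(2) by simp
  qed
  define s where "s = (LEAST i. card (above G i) \<le> k)"
  have "above G (n - 1) = {}"
    using deg_le_order[OF G] n by (fastforce simp: above_def)
  then have above_top: "card (above G (n - 1)) \<le> k" by (simp only: card.empty le0)
  have s: "card (above G s) \<le> k" unfolding s_def
    by (rule LeastI[of _ "n - 1"]) (rule above_top)
  have sn: "s \<le> n - 1" unfolding s_def by (rule Least_le) (rule above_top)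
  have before_s: "k < card (above G i)" if "i < s" for i
    using not_less_Least[of i "\<lambda>i. card (above G i) \<le> k"] that by (simp add: s_def)
  have after_s: "card (above G i) \<le> k" if "s \<le> i" for i
  proof -
    have "above G i \<subseteq> above G s" using that by (auto simp: above_def)
    then have "card (above G i) \<le> card (above G s)" by (rule card_mono[OF finite_above[OF G]])
    then show ?thesis using s by simp
  qed
  (* For i < k every vertex lies above i, and n > k. *)
  have ks: "k \<le> s"
  proof (rule ccontr)
    assume "\<not> k \<le> s"
    then have "above G s = verts G" using deg by (fastforce simp: above_def)
    then show False using s n k by (simp add: graph_order_def)
  qed
  have high: "(\<Sum>i\<in>{s..<n - 1}. ?w i * ?c i) \<le> (\<Sum>i\<in>{s..<n - 1}. ?w i * ?p)"
    using w_pos cut_le_p after_s ks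
    by (intro sum_mono mult_left_mono) (auto simp del: of_nat_Suc intro: less_imp_le)
  have split: "(\<Sum>i\<in>{k..<n - 1}. f i) = (\<Sum>i\<in>{k..<s}. f i) + (\<Sum>i\<in>{s..<n - 1}. f i)"
    for f :: "nat \<Rightarrow> real"
    using sum.atLeastLessThan_concat[OF ks sn, of f] by simp
  have low: "(\<Sum>i\<in>{k..<s}. ?w i * ?c i) < (\<Sum>i\<in>{k..<s}. ?w i * ?p)" if "k < s"
  proof -
    have "{u \<in> verts G. deg G u < s} = {u \<in> verts G. deg G u \<le> s - 1}" using that by auto
    then have few: "card {u \<in> verts G. deg G u < s} < n - k"
      using card_not_above[OF G, of "s - 1"] before_s[of "s - 1"] that k n by simp
    have "(\<Sum>i\<in>{k..<s}. ?w i * ?c i)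
        \<le> real (card {u \<in> verts G. deg G u < s}) * (1 - real k / real s)"
      by (rule low_layers_le[OF G k(1) ks deg])
    also have "\<dots> < real (n - k) * (1 - real k / real s)"
      using few that by (intro mult_strict_right_mono) auto
    also have "\<dots> = (1 / real k - 1 / real s) * ?p"
      using k that by (simp add: of_nat_diff field_simps)
    also have "\<dots> = (\<Sum>i\<in>{k..<s}. ?w i * ?p)"
      using telescope_reciprocals[OF ks] by (simp only: sum_distrib_right[symmetric])
    finally show ?thesis .
  qed
  show "degree_gap G \<le> M"
  proof (cases "k < s")
    case True
    then show ?thesis unfolding gap M_sum split using low high by linarith
  next
    case False
    then have "s = k" using ks by simp
    then show ?thesis unfolding gap M_sum using high by simp
  qed
  assume eq: "degree_gap G = M"
  have sk: "s = k"
  proof (rule ccontr)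
    assume "s \<noteq> k"
    then have "k < s" using ks by simp
    then show False using eq low high unfolding gap M_sum split by linarith
  qed
  have tight: "card (above G i) = k" if i: "i \<in> {k..<n - 1}" for i
  proof (rule above_eq)
    show ai: "card (above G i) \<le> k" using after_s sk i by simp
    have le: "?w j * ?c j \<le> ?w j * ?p" if "j \<in> {k..<n - 1}" for j
      using that w_pos[of j] cut_le_p[of j] after_s[of j] sk
      by (intro mult_left_mono) (auto simp del: of_nat_Suc)
    have "?w i * ?c i = ?w i * ?p"
      using sum_mono_inv[OF eq[unfolded gap M_sum] le i] by simp
    then show "?c i = ?p" using w_pos[of i] i by (simp del: of_nat_Suc)
  qed
  show "\<exists>B \<subseteq> verts G. card B = k \<and>
      (\<forall>u\<in>B. deg G u = n - 1) \<and> (\<forall>u\<in>verts G - B. deg G u = k)"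
  proof (cases "k = n - 1")
    (* There are no layers here: n = 2, k = 1, G is a single edge, and either end can form B. *)
    case True
    obtain B where "B \<subseteq> verts G" "card B = k"
      using obtain_subset_with_card_n[of k "verts G"] n k by (auto simp: graph_order_def)
    moreover have "deg G u = k" if "u \<in> verts G" for u
      using deg[OF that] deg_le_order[OF G that] n True by simp
    ultimately show ?thesis using True by (intro exI[of _ B]) auto
  next
    case False
    then have kn2: "k \<in> {k..<n - 1}" "n - 2 \<in> {k..<n - 1}" using kn by auto
    (* As many vertices exceed degree k as exceed degree n - 2, so no degree lies in between. *)
    have "above G (n - 2) \<subseteq> above G k" using kn2 by (auto simp: above_def)
    then have same: "above G (n - 2) = above G k"
      using tight[OF kn2(1)] tight[OF kn2(2)]
      by (intro card_subset_eq finite_above[OF G]) auto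
    have "deg G u = n - 1" if "u \<in> above G k" for u
    proof -
      have "u \<in> above G (n - 2)" using that same by simp
      then have "u \<in> verts G" "n - 2 < deg G u" by (auto simp: above_def)
      then show ?thesis using deg_le_order[OF G, of u] n by simp
    qed
    moreover have "deg G u = k" if "u \<in> verts G - above G k" for u
      using that deg[of u] by (auto simp: above_def)
    moreover have "above G k \<subseteq> verts G" by (auto simp: above_def)
    ultimately show ?thesis using tight[OF kn2(1)]
      by (intro exI[of _ "above G k"] conjI ballI)
  qed
qed

section \<open>The family of complements of regular graphs\<close>

lemma deg_complement:
  assumes V: "finite V" "u \<in> V" and H: "edges H \<subseteq> complete_edges V"
    and G: "edges G = complete_edges V - edges H"
  shows "deg G u = card V - 1 - deg H u"
proof -
  let ?K = "\<lparr>verts = V, edges = complete_edges V\<rparr>"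
  have K: "simple_graph ?K" using V by (simp add: simple_graph_def)
  have "nbrs ?K u = V - {u}"
    using nbrs_subset[OF K, of u] V(2) by (auto simp: nbrs_def complete_edges_def)
  then have dK: "deg ?K u = card V - 1" using V card_nbrs[OF K, of u] by simp
  have "finite {e \<in> edges H. u \<in> e}"
    using finite_edges[OF K] H by (auto intro: finite_subset)
  moreover have "{e \<in> edges H. u \<in> e} \<subseteq> {e \<in> edges ?K. u \<in> e}" using H by auto
  moreover have "{e \<in> edges G. u \<in> e} = {e \<in> edges ?K. u \<in> e} - {e \<in> edges H. u \<in> e}"
    using G by auto
  ultimately show ?thesis using dK by (simp add: deg_def card_Diff_subset)
qed

text \<open>The vertices outside the deleted regular graph keep degree \<open>n - 1\<close>, the others drop to
  \<open>n - 1 - (n - k - 1) = k\<close>.\<close>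

lemma G_family_degrees:
  assumes "G \<in> G_family n p k" and kn: "k < n"
  obtains B where "B \<subseteq> verts G" "card B = n - p" "\<And>u. u \<in> B \<Longrightarrow> deg G u = n - 1"
    "\<And>u. u \<in> verts G - B \<Longrightarrow> deg G u = k"
proof -
  from assms obtain H where G: "simple_graph G" "graph_order G = n"
    and H: "simple_graph H" "verts H \<subseteq> verts G" "graph_order H = p" "regular (n - k - 1) H"
    and e: "edges G = complete_edges (verts G) - edges H"
    by (auto simp: G_family_def)
  have finV: "finite (verts G)" using G by (simp add: simple_graph_def)
  have EH: "edges H \<subseteq> complete_edges (verts G)"
    using H by (auto simp: simple_graph_def complete_edges_def)
  have deg: "deg G u = n - 1 - deg H u" if "u \<in> verts G" for u
    using deg_complement[OF finV that EH e] G by (simp add: graph_order_def)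
  show ?thesis
  proof
    show "card (verts G - verts H) = n - p"
      using H G finV by (simp add: card_Diff_subset graph_order_def finite_subset)
    show "deg G u = n - 1" if "u \<in> verts G - verts H" for u
    proof -
      have "{e \<in> edges H. u \<in> e} = {}"
        using H that by (auto simp: simple_graph_def complete_edges_def)
      then have "deg H u = 0" unfolding deg_def by (simp only: card.empty)
      then show ?thesis using deg that by simp
    qed
    show "deg G u = k" if "u \<in> verts G - (verts G - verts H)" for u
      using that deg[of u] H kn by (auto simp: regular_def)
  qed auto
qed

section \<open>Lower bounds for the index and their equality cases\<close>

theorem theorem1:
  fixes G :: "'a ugraph" and n k :: nat
  assumes "n > 0" and "k > 0"
    and "simple_graph G"
    and "graph_order G = n"
    and "min_degree G \<ge> k"
  shows
    "(real k \<le> real n / 2 \<longrightarrow>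
        randic_var G \<ge>
          real n / 2 - 1 / 2 * (1 / real k - 1 / (real n - 1)) * (real k * (real n - real k)) \<and>
        (randic_var G =
          real n / 2 - 1 / 2 * (1 / real k - 1 / (real n - 1)) * (real k * (real n - real k))
          \<longleftrightarrow> graph_iso G (complete_split k (n - k)))) \<and>
     (real n / 2 \<le> real k \<and> real k \<le> real n - 2 \<longrightarrow>
        randic_var G \<ge>
          real n / 2 - 1 / 2 * (1 / real k - 1 / (real n - 1)) * ((real n)\<^sup>2 / 4) \<and>
        ((n mod 4 = 0 \<or> (n mod 4 = 2 \<and> odd k)) \<and> G \<in> G_family n (n div 2) k \<longrightarrow>
          randic_var G =
            real n / 2 - 1 / 2 * (1 / real k - 1 / (real n - 1)) * ((real n)\<^sup>2 / 4)))"
proof -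
  note G = assms(3) and n = assms(4)
  have finV: "finite (verts G)" using G by (simp add: simple_graph_def)
  have k1: "1 \<le> k" using assms(2) by simp
  have deg: "k \<le> deg G u" if "u \<in> verts G" for u
    using assms(5) finV that unfolding min_degree_def
    by (meson Min_le finite_imageI imageI le_trans)
  have "deg G u > 0" if "u \<in> verts G" for u using deg[OF that] k1 by simp
  then have randic: "randic_var G = real n / 2 - degree_gap G / 2"
    using randic_var_eq_degree_gap[OF G] n by simp
  let ?M = "(1 / real k - 1 / (real n - 1)) * (real k * (real n - real k))"
  let ?Q = "(1 / real k - 1 / (real n - 1)) * ((real n)\<^sup>2 / 4)"
  have small: "randic_var G \<ge> real n / 2 - ?M / 2
      \<and> (randic_var G = real n / 2 - ?M / 2 \<longleftrightarrow> graph_iso G (complete_split k (n - k)))"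
    if "real k \<le> real n / 2"
  proof -
    have kn: "2 * k \<le> n" using that by linarith
    then have kn1: "k \<le> n" "k \<le> n - 1" using k1 by auto
    have "randic_var G = real n / 2 - ?M / 2 \<longleftrightarrow> graph_iso G (complete_split k (n - k))"
    proof
      assume "randic_var G = real n / 2 - ?M / 2"
      then have "degree_gap G = ?M" using randic by simp
      then obtain B where "B \<subseteq> verts G" "card B = k"
        "\<forall>u\<in>B. deg G u = n - 1" "\<forall>u\<in>verts G - B. deg G u = k"
        using degree_gap_le_split(2)[OF G n k1 kn deg] by blast
      then show "graph_iso G (complete_split k (n - k))"
        using complete_split_structure_of_degrees[OF G n, of B]
        unfolding graph_iso_complete_split_iff[OF G n kn1(1)]
        by (intro exI[of _ B]) auto
    next
      assume "graph_iso G (complete_split k (n - k))"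
      then obtain B where B: "B \<subseteq> verts G" "card B = k"
        and nb: "\<And>u v. u \<in> verts G \<Longrightarrow> v \<in> verts G \<Longrightarrow>
          v \<in> nbrs G u \<longleftrightarrow> u \<noteq> v \<and> (u \<in> B \<or> v \<in> B)"
        unfolding graph_iso_complete_split_iff[OF G n kn1(1)] by auto
      have "deg G u = (if u \<in> B then n - 1 else k)" if "u \<in> verts G" for u
        by (rule complete_split_degrees[OF G n B nb that])
      then have "\<And>u. u \<in> B \<Longrightarrow> deg G u = n - 1" "\<And>u. u \<in> verts G - B \<Longrightarrow> deg G u = k"
        using B(1) by auto
      then show "randic_var G = real n / 2 - ?M / 2"
        using randic_var_two_degrees[OF G n k1 kn1(2) B(1)] B(2) by simp
    qed
    then show ?thesis using randic degree_gap_le_split(1)[OF G n k1 kn deg] by auto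
  qed
  have large: "randic_var G \<ge> real n / 2 - ?Q / 2
      \<and> ((n mod 4 = 0 \<or> (n mod 4 = 2 \<and> odd k)) \<and> G \<in> G_family n (n div 2) k \<longrightarrow>
          randic_var G = real n / 2 - ?Q / 2)"
    if "real k \<le> real n - 2"
  proof -
    have kn: "k \<le> n - 1" "k < n" using that by linarith+
    have "randic_var G = real n / 2 - ?Q / 2"
      if par: "n mod 4 = 0 \<or> n mod 4 = 2" and fam: "G \<in> G_family n (n div 2) k"
    proof -
      have "even n" using par by presburger
      then have half: "real (n - n div 2) = real n / 2" by (auto elim!: evenE)
      obtain B where B: "B \<subseteq> verts G" "card B = n - n div 2"
        "\<And>u. u \<in> B \<Longrightarrow> deg G u = n - 1" "\<And>u. u \<in> verts G - B \<Longrightarrow> deg G u = k"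
        using G_family_degrees[OF fam kn(2)] by blast
      have "real (card B) * (real n - real (card B)) = (real n)\<^sup>2 / 4"
        unfolding B(2) half by (simp add: power2_eq_square)
      then show ?thesis using randic_var_two_degrees[OF G n k1 kn(1) B(1,3,4)] by simp
    qed
    then show ?thesis using randic degree_gap_le_quarter[OF G n k1 kn(1) deg] by auto
  qed
  show ?thesis using small large by simp
qed

end
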